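(* If $\mathfrak A$ is a Boolean algebra in the class $\mathcal I(1)$ and $\mu$ is a nonatomic measure on $\mathfrak A$, then $\mu$ is strongly countably determined.
   Context: A family $\{a_i:i\in I\}$ in a Boolean algebra is independent if $\bigcap_{i\in I'}a_i\cap\bigcap_{i\in I''}a_i^c\neq 0$ for all finite disjoint $I',I''\subseteq I$. For $n\ge1$, a Boolean algebra $\mathfrak A$ is in the class $\mathcal I(n)$ if it is generated by a family $\mathcal G\subseteq\mathfrak A$ that contains no $n+1$ independent elements. A measure on a Boolean algebra $\mathfrak A$ is a finitely additive nonnegative probability functional $\mu:\mathfrak A\to[0,1]$. It is nonatomic if for every $\varepsilon>0$ there are $n\ge1$ and a finite partition $\{a_1,\dots,a_n\}$ of $1_{\mathfrak A}$ with $\mu(a_i)<\varepsilon$ for every $i\le n$. It is strongly countably determined if there is a countable subalgebra $\mathfrak C\subseteq\mathfrak A$ such that for every $a\in\mathfrak A$, $\mu(a)=\sup\{\mu(c): c\in\mathfrak C,\ c\subseteq a\}$, where $\subseteq$ is the order of the Boolean algebra. *)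

theory Defs
  imports Complex_Main "HOL-Library.Countable_Set"
begin

text \<open>
  A Boolean algebra is a type of class \<open>boolean_algebra\<close>. The class admits the one-element
  algebra, but that algebra carries no probability measure.
\<close>

text \<open>Finite meets of indexed families; the empty meet is \<open>top\<close>.\<close>

global_interpretation fin_meet: comm_monoid_set inf "top :: 'a::boolean_algebra"
  defines fin_meet = fin_meet.F
  by unfold_locales (simp_all add: ac_simps)

definition independent_family :: "('i \<Rightarrow> 'a::boolean_algebra) \<Rightarrow> 'i set \<Rightarrow> bool" where
  "independent_family a I \<longleftrightarrow>
     (\<forall>J K. finite J \<and> finite K \<and> J \<subseteq> I \<and> K \<subseteq> I \<and> J \<inter> K = {} \<longrightarrow>
        inf (fin_meet a J) (fin_meet (\<lambda>i. - a i) K) \<noteq> bot)"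

definition subalgebra :: "'a::boolean_algebra set \<Rightarrow> bool" where
  "subalgebra B \<longleftrightarrow>
     bot \<in> B \<and> top \<in> B \<and> (\<forall>x\<in>B. - x \<in> B) \<and>
     (\<forall>x\<in>B. \<forall>y\<in>B. inf x y \<in> B) \<and> (\<forall>x\<in>B. \<forall>y\<in>B. sup x y \<in> B)"

text \<open>
  The class \<open>I(n)\<close>, for \<open>n \<ge> 1\<close>. As repeated members always destroy independence, \<open>n + 1\<close>
  independent elements of \<open>G\<close> are a subset of \<open>G\<close> of cardinality \<open>n + 1\<close>, indexed by itself.
\<close>

definition class_I :: "nat \<Rightarrow> 'a::boolean_algebra itself \<Rightarrow> bool" where
  "class_I n (_ :: 'a itself) \<longleftrightarrow>
     (\<exists>G :: 'a set. subalgebra hull G = UNIV \<and>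
        \<not> (\<exists>F. F \<subseteq> G \<and> card F = n + 1 \<and> independent_family (\<lambda>x. x) F))"

definition ba_measure :: "('a::boolean_algebra \<Rightarrow> real) \<Rightarrow> bool" where
  "ba_measure \<mu> \<longleftrightarrow>
     (\<forall>a. 0 \<le> \<mu> a \<and> \<mu> a \<le> 1) \<and> \<mu> top = 1 \<and>
     (\<forall>a b. inf a b = bot \<longrightarrow> \<mu> (sup a b) = \<mu> a + \<mu> b)"

text \<open>
  Whether \<open>bot\<close> may be a member of a partition is immaterial below, since a null member can be
  discarded.
\<close>

definition finite_partition :: "'a::boolean_algebra set \<Rightarrow> bool" where
  "finite_partition P \<longleftrightarrow>
     finite P \<and> P \<noteq> {} \<and> pairwise (\<lambda>a b. inf a b = bot) P \<and> Sup_fin P = top"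

definition nonatomic :: "('a::boolean_algebra \<Rightarrow> real) \<Rightarrow> bool" where
  "nonatomic \<mu> \<longleftrightarrow> (\<forall>\<epsilon>>0. \<exists>P. finite_partition P \<and> (\<forall>a\<in>P. \<mu> a < \<epsilon>))"

definition strongly_countably_determined :: "('a::boolean_algebra \<Rightarrow> real) \<Rightarrow> bool" where
  "strongly_countably_determined \<mu> \<longleftrightarrow>
     (\<exists>C. countable C \<and> subalgebra C \<and> (\<forall>a. \<mu> a = (SUP c\<in>{c \<in> C. c \<le> a}. \<mu> c)))"

end

theory Submission
  imports Defs
begin

text \<open>
  Let \<open>G\<close> generate the algebra and contain no two independent elements. A finite set \<open>F \<subseteq> G\<close> cuts
  the unit into finitely many cells, any two of which lie on different sides of some \<open>h \<in> F\<close>.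
  The point is that an element \<open>g \<in> G\<close> cuts at most one of these cells properly: if it cut both
  \<open>p \<le> h\<close> and \<open>q \<le> - h\<close>, then \<open>g\<close> and \<open>- g\<close> would both meet \<open>h\<close> inside \<open>p\<close> and \<open>- h\<close> inside \<open>q\<close>,
  so \<open>g\<close> and \<open>h\<close> would be independent (\<open>splits_at_most_one_cell\<close>).

  A partition into pieces of measure less than \<open>\<epsilon>\<close> involves only finitely many generators, and for
  these the cells have measure less than \<open>\<epsilon>\<close> as well. The cells below \<open>g\<close> and the cells below \<open>- g\<close>
  therefore exhaust everything but a single cell of measure less than \<open>\<epsilon>\<close>, whatever \<open>g \<in> G\<close> is
  (\<open>generator_squeezed\<close>). Letting \<open>\<epsilon>\<close> run through \<open>1 / (n + 1)\<close>, countably many generators suffice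
  to generate a subalgebra \<open>C\<close> that approximates every \<open>g \<in> G\<close> both from below and from above.
  The elements approximable in this two-sided sense form a subalgebra
  (\<open>subalgebra_squeezed\<close>), as the Jordan measurable sets do, so they fill the whole algebra.
\<close>

section \<open>Generated subalgebras\<close>

lemma subalgebraD:
  assumes "subalgebra B"
  shows "bot \<in> B" "top \<in> B" "x \<in> B \<Longrightarrow> - x \<in> B"
    "x \<in> B \<Longrightarrow> y \<in> B \<Longrightarrow> inf x y \<in> B" "x \<in> B \<Longrightarrow> y \<in> B \<Longrightarrow> sup x y \<in> B"
  using assms unfolding subalgebra_def by auto

lemma subalgebraI:
  assumes "bot \<in> B" "top \<in> B" "\<And>x. x \<in> B \<Longrightarrow> - x \<in> B"
    and "\<And>x y. x \<in> B \<Longrightarrow> y \<in> B \<Longrightarrow> inf x y \<in> B \<and> sup x y \<in> B"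
  shows "subalgebra B"
  using assms unfolding subalgebra_def by simp

lemma subalgebra_hull: "subalgebra (subalgebra hull S)"
  by (rule hull_in) (auto simp: subalgebra_def)

primrec closure_stage :: "'a::boolean_algebra set \<Rightarrow> nat \<Rightarrow> 'a set" where
  "closure_stage X 0 = X \<union> {bot, top}"
| "closure_stage X (Suc n) = closure_stage X n \<union> uminus ` closure_stage X n
     \<union> (\<lambda>(x, y). inf x y) ` (closure_stage X n \<times> closure_stage X n)
     \<union> (\<lambda>(x, y). sup x y) ` (closure_stage X n \<times> closure_stage X n)"

lemma countable_closure_stage: "countable X \<Longrightarrow> countable (closure_stage X n)"
  by (induction n) auto

lemma closure_stage_mono: "m \<le> n \<Longrightarrow> closure_stage X m \<subseteq> closure_stage X n"
  by (rule lift_Suc_mono_le[of "closure_stage X"]) auto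

lemma subalgebra_Union_closure_stage: "subalgebra (\<Union>n. closure_stage X n)"
proof -
  have binary: "inf x y \<in> (\<Union>n. closure_stage X n) \<and> sup x y \<in> (\<Union>n. closure_stage X n)"
    if "x \<in> closure_stage X m" "y \<in> closure_stage X n" for x y m n
  proof -
    have "x \<in> closure_stage X (max m n)" "y \<in> closure_stage X (max m n)"
      using that closure_stage_mono[of m "max m n" X] closure_stage_mono[of n "max m n" X] by auto
    then have "inf x y \<in> closure_stage X (Suc (max m n))" "sup x y \<in> closure_stage X (Suc (max m n))"
      by auto
    then show ?thesis by blast
  qed
  have "- x \<in> (\<Union>n. closure_stage X n)" if "x \<in> closure_stage X n" for x n
  proof -
    have "- x \<in> closure_stage X (Suc n)" using that by simp
    then show ?thesis by blast
  qed
  moreover have "bot \<in> closure_stage X 0" "top \<in> closure_stage X 0" by auto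
  then have "bot \<in> (\<Union>n. closure_stage X n)" "top \<in> (\<Union>n. closure_stage X n)" by blast+
  ultimately show ?thesis
    using binary by (intro subalgebraI) (simp_all only: UN_iff, blast+)
qed

lemma countable_subalgebra_hull:
  assumes "countable X"
  shows "countable (subalgebra hull X)"
proof (rule countable_subset)
  have "X \<subseteq> closure_stage X 0" by auto
  then have "X \<subseteq> (\<Union>n. closure_stage X n)" by blast
  then show "subalgebra hull X \<subseteq> (\<Union>n. closure_stage X n)"
    by (rule hull_minimal) (rule subalgebra_Union_closure_stage)
  show "countable (\<Union>n. closure_stage X n)"
    using countable_closure_stage[OF assms] by simp
qed

text \<open>Generation is finitary, because the generated subalgebras of the finite subsets of \<open>G\<close> are
  directed by inclusion and so have a subalgebra as their union.\<close>

lemma in_subalgebra_hull_finite: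
  assumes "x \<in> subalgebra hull G"
  shows "\<exists>F. finite F \<and> F \<subseteq> G \<and> x \<in> subalgebra hull F"
  using assms
proof (rule hull_induct)
  show "\<exists>F. finite F \<and> F \<subseteq> G \<and> x \<in> subalgebra hull F" if "x \<in> G" for x
    using that by (intro exI[of _ "{x}"]) (auto intro: hull_inc)
next
  let ?S = "{x. \<exists>F. finite F \<and> F \<subseteq> G \<and> x \<in> subalgebra hull F}"
  have binary: "inf x y \<in> ?S \<and> sup x y \<in> ?S" if xy: "x \<in> ?S" "y \<in> ?S" for x y
  proof -
    obtain F H where FH: "finite F" "F \<subseteq> G" "x \<in> subalgebra hull F"
      "finite H" "H \<subseteq> G" "y \<in> subalgebra hull H"
      using xy by blast
    then have "x \<in> subalgebra hull (F \<union> H)" "y \<in> subalgebra hull (F \<union> H)"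
      using hull_mono[of F "F \<union> H" subalgebra] hull_mono[of H "F \<union> H" subalgebra] by auto
    then have "inf x y \<in> subalgebra hull (F \<union> H)" "sup x y \<in> subalgebra hull (F \<union> H)"
      using subalgebraD[OF subalgebra_hull] by blast+
    with FH show ?thesis by (auto intro!: exI[of _ "F \<union> H"])
  qed
  have "bot \<in> ?S" "top \<in> ?S"
    using subalgebraD[OF subalgebra_hull[of "{}"]] by auto
  moreover have "- x \<in> ?S" if "x \<in> ?S" for x
    using that subalgebraD(3)[OF subalgebra_hull] by blast
  ultimately show "subalgebra ?S"
    using binary by (intro subalgebraI)
qed

lemma finite_subset_subalgebra_hull:
  assumes "finite Q" "Q \<subseteq> subalgebra hull G"
  shows "\<exists>F. finite F \<and> F \<subseteq> G \<and> Q \<subseteq> subalgebra hull F"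
proof -
  obtain f where f: "\<And>q. q \<in> Q \<Longrightarrow> finite (f q) \<and> f q \<subseteq> G \<and> q \<in> subalgebra hull f q"
    using in_subalgebra_hull_finite assms(2) by (metis subsetD)
  have "q \<in> subalgebra hull (\<Union>q\<in>Q. f q)" if "q \<in> Q" for q
    using f[OF that] hull_mono[of "f q" "\<Union>q\<in>Q. f q" subalgebra] that by blast
  then show ?thesis
    using f assms(1) by (intro exI[of _ "\<Union>q\<in>Q. f q"]) auto
qed

lemma finite_join_in_subalgebra:
  assumes "finite S" "S \<subseteq> C" "subalgebra C"
  shows "\<exists>c\<in>C. \<forall>y. c \<le> y \<longleftrightarrow> (\<forall>s\<in>S. s \<le> y)"
  using assms
proof (induction S)
  case empty
  then show ?case by (intro bexI[of _ bot]) (auto dest: subalgebraD)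
next
  case (insert x S)
  then obtain c where "c \<in> C" "\<forall>y. c \<le> y \<longleftrightarrow> (\<forall>s\<in>S. s \<le> y)" by auto
  with insert.prems show ?case
    by (intro bexI[of _ "sup x c"]) (auto intro: subalgebraD)
qed

section \<open>The cells of a finite set of generators\<close>

text \<open>
  That the join of \<open>P\<close> is \<open>top\<close> is expressed through upper bounds, which fits the empty set too.
  Disjointness of the cells is implied by the last condition. The element \<open>bot\<close> may occur as a cell,
  so that cutting every cell by one more generator needs no case distinction.
\<close>

definition cells :: "'a::boolean_algebra set \<Rightarrow> 'a set \<Rightarrow> bool" where
  "cells F P \<longleftrightarrow> finite P \<and> P \<subseteq> subalgebra hull F \<and>
     (\<forall>y. (\<forall>p\<in>P. p \<le> y) \<longrightarrow> y = top) \<and>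
     (\<forall>p\<in>P. \<forall>h\<in>F. p \<le> h \<or> p \<le> - h) \<and>
     (\<forall>p\<in>P. \<forall>q\<in>P. p \<noteq> q \<longrightarrow> (\<exists>h\<in>F. p \<le> h \<and> q \<le> - h \<or> q \<le> h \<and> p \<le> - h))"

lemma cellsI:
  assumes "finite P" "P \<subseteq> subalgebra hull F"
    and "\<And>y. \<forall>p\<in>P. p \<le> y \<Longrightarrow> y = top"
    and "\<And>p h. p \<in> P \<Longrightarrow> h \<in> F \<Longrightarrow> p \<le> h \<or> p \<le> - h"
    and "\<And>p q. p \<in> P \<Longrightarrow> q \<in> P \<Longrightarrow> p \<noteq> q \<Longrightarrow> \<exists>h\<in>F. p \<le> h \<and> q \<le> - h \<or> q \<le> h \<and> p \<le> - h"
  shows "cells F P"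
  using assms unfolding cells_def by simp

lemma le_if_both_parts_le:
  fixes p h y :: "'a::boolean_algebra"
  assumes "inf p h \<le> y" "inf p (- h) \<le> y"
  shows "p \<le> y"
proof -
  have "p = sup (inf p h) (inf p (- h))" by (simp flip: inf_sup_distrib1)
  with assms show ?thesis by (metis le_sup_iff)
qed

lemma cells_exist:
  assumes "finite F"
  shows "\<exists>P. cells F P"
  using assms
proof (induction F)
  case empty
  show ?case
    by (intro exI[of _ "{top}"])
       (auto simp: cells_def top_unique subalgebraD[OF subalgebra_hull])
next
  case (insert h F)
  then obtain P where P: "cells F P" by blast
  let ?P = "(\<lambda>p. inf p h) ` P \<union> (\<lambda>p. inf p (- h)) ` P"
  have sub: "P \<subseteq> subalgebra hull insert h F"
    using P hull_mono[of F "insert h F" subalgebra] unfolding cells_def by blast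
  have "h \<in> subalgebra hull insert h F" by (simp add: hull_inc)
  then have 1: "?P \<subseteq> subalgebra hull insert h F"
    using sub subalgebraD[OF subalgebra_hull[of "insert h F"]] by blast
  have 2: "y = top" if "\<forall>p\<in>?P. p \<le> y" for y
  proof -
    have "\<forall>p\<in>P. p \<le> y" using that by (blast intro: le_if_both_parts_le)
    with P show ?thesis unfolding cells_def by blast
  qed
  have 3: "q \<le> k \<or> q \<le> - k" if "q \<in> ?P" "k \<in> insert h F" for q k
  proof -
    obtain p where p: "p \<in> P" "q = inf p h \<or> q = inf p (- h)"
      using \<open>q \<in> ?P\<close> by blast
    show ?thesis
    proof (cases "k = h")
      case True
      then show ?thesis using p(2) by auto
    next
      case False
      then have "p \<le> k \<or> p \<le> - k"
        using p(1) P \<open>k \<in> insert h F\<close> unfolding cells_def by blast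
      then show ?thesis using p(2) by (auto intro: le_infI1)
    qed
  qed
  have 4: "\<exists>k\<in>insert h F. q \<le> k \<and> r \<le> - k \<or> r \<le> k \<and> q \<le> - k"
    if qr: "q \<in> ?P" "r \<in> ?P" "q \<noteq> r" for q r
  proof -
    obtain p p' where p: "p \<in> P" "p' \<in> P"
      and q: "q = inf p h \<or> q = inf p (- h)" and r: "r = inf p' h \<or> r = inf p' (- h)"
      using qr(1,2) by blast
    show ?thesis
    proof (cases "p = p'")
      case True
      with q r qr(3) show ?thesis by auto
    next
      case False
      then obtain k where "k \<in> F" "p \<le> k \<and> p' \<le> - k \<or> p' \<le> k \<and> p \<le> - k"
        using P p unfolding cells_def by blast
      then have "k \<in> insert h F" "q \<le> k \<and> r \<le> - k \<or> r \<le> k \<and> q \<le> - k"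
        using q r by (auto intro: le_infI1)
      then show ?thesis by blast
    qed
  qed
  have "finite ?P" using P by (simp add: cells_def)
  then have "cells (insert h F) ?P"
    using 1 2 3 4 by (rule cellsI)
  then show ?case by blast
qed

lemma cell_decides_generated:
  assumes "cells F P" "p \<in> P" "x \<in> subalgebra hull F"
  shows "p \<le> x \<or> p \<le> - x"
  using assms(3)
proof (rule hull_induct)
  show "p \<le> x \<or> p \<le> - x" if "x \<in> F" for x
    using assms(1,2) that unfolding cells_def by blast
  show "subalgebra {x. p \<le> x \<or> p \<le> - x}"
    unfolding subalgebra_def by (auto intro: le_supI1 le_supI2 le_infI1 le_infI2)
qed

section \<open>Elements without independent pairs\<close>

lemma independent_pairI:
  fixes g h :: "'a::boolean_algebra"
  assumes "inf g h \<noteq> bot" "inf g (- h) \<noteq> bot" "inf (- g) h \<noteq> bot" "inf (- g) (- h) \<noteq> bot"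
  shows "g \<noteq> h" "independent_family (\<lambda>x. x) {g, h}"
proof -
  show neq: "g \<noteq> h" using assms(2) by auto
  have lower: "fin_meet f {g, h} \<le> fin_meet f J"
    if "J \<subseteq> {g, h}" for J and f :: "'a \<Rightarrow> 'a"
  proof -
    have "J = {} \<or> J = {g} \<or> J = {h} \<or> J = {g, h}" using that by auto
    then show ?thesis using neq by (auto simp: le_infI1 le_infI2)
  qed
  show "independent_family (\<lambda>x. x) {g, h}"
    unfolding independent_family_def
  proof (intro allI impI, elim conjE)
    fix J K :: "'a set"
    assume JK: "J \<subseteq> {g, h}" "K \<subseteq> {g, h}" "J \<inter> K = {}"
    define s where "s x = (if x \<in> J then x else - x)" for x
    \<comment> \<open>The meet in question lies above one of the four full sign patterns.\<close>
    have "inf (s g) (s h) \<le> fin_meet (\<lambda>x. x) J"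
    proof -
      have "fin_meet (\<lambda>x. x) J = fin_meet s J"
        by (rule fin_meet.cong) (auto simp: s_def)
      then show ?thesis using lower[OF JK(1), of s] neq by simp
    qed
    moreover have "inf (s g) (s h) \<le> fin_meet (\<lambda>x. - x) K"
    proof -
      have "fin_meet (\<lambda>x. - x) K = fin_meet s K"
        by (rule fin_meet.cong) (use JK in \<open>auto simp: s_def\<close>)
      then show ?thesis using lower[OF JK(2), of s] neq by simp
    qed
    moreover have "inf (s g) (s h) \<noteq> bot" using assms by (simp add: s_def)
    ultimately show "inf (fin_meet (\<lambda>x. x) J) (fin_meet (\<lambda>x. - x) K) \<noteq> bot"
      by (metis le_inf_iff bot_unique)
  qed
qed

text \<open>
  If \<open>g\<close> cuts two cells that a generator \<open>h\<close> separates, then one of the cells provides the two meets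
  of \<open>g\<close> and \<open>- g\<close> with \<open>h\<close>, the other one the two meets with \<open>- h\<close>.
\<close>

lemma splits_at_most_one_cell:
  fixes G :: "'a::boolean_algebra set"
  assumes G: "\<not> (\<exists>F. F \<subseteq> G \<and> card F = 2 \<and> independent_family (\<lambda>x. x) F)"
    and "F \<subseteq> G" "cells F P" "g \<in> G"
    and p: "p \<in> P" "\<not> p \<le> g" "\<not> p \<le> - g" and q: "q \<in> P" "\<not> q \<le> g" "\<not> q \<le> - g"
  shows "p = q"
proof (rule ccontr)
  assume "p \<noteq> q"
  have sep: False
    if "h \<in> F" "p \<le> h" "q \<le> - h" "\<not> p \<le> g" "\<not> p \<le> - g" "\<not> q \<le> g" "\<not> q \<le> - g" for h p q
  proof -
    have meets: "inf g x \<noteq> bot \<and> inf (- g) x \<noteq> bot" if "r \<le> x" "\<not> r \<le> g" "\<not> r \<le> - g" for r x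
    proof -
      have "inf g r \<noteq> bot" "inf (- g) r \<noteq> bot"
        using that by (simp_all add: inf_shunt inf_commute[of _ r])
      moreover have "inf g r \<le> inf g x" "inf (- g) r \<le> inf (- g) x"
        using \<open>r \<le> x\<close> by (auto intro: le_infI2)
      ultimately show ?thesis by (metis bot_unique)
    qed
    have "g \<noteq> h" "independent_family (\<lambda>x. x) {g, h}"
      using meets[of p h] meets[of q "- h"] that independent_pairI[of g h] by blast+
    moreover have "{g, h} \<subseteq> G" using that \<open>F \<subseteq> G\<close> \<open>g \<in> G\<close> by auto
    ultimately show False using G by (metis card_2_iff)
  qed
  obtain h where "h \<in> F" "p \<le> h \<and> q \<le> - h \<or> q \<le> h \<and> p \<le> - h"
    using \<open>cells F P\<close> \<open>p \<in> P\<close> \<open>q \<in> P\<close> \<open>p \<noteq> q\<close> unfolding cells_def by blast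
  then show False using sep[of h p q] sep[of h q p] p q by blast
qed

section \<open>Two-sided approximation\<close>

lemma measure_bot: "ba_measure \<mu> \<Longrightarrow> \<mu> bot = 0"
  unfolding ba_measure_def by (metis add_cancel_right_right inf_bot_left sup_bot_left)

lemma measure_diff:
  assumes "ba_measure \<mu>" "a \<le> b"
  shows "\<mu> b = \<mu> a + \<mu> (inf b (- a))"
proof -
  have "inf a (inf b (- a)) = bot" by (simp add: inf_left_commute)
  moreover have "sup a (inf b (- a)) = b"
    using assms(2) by (simp add: sup_inf_distrib1 sup_absorb2)
  ultimately show ?thesis using assms(1) unfolding ba_measure_def by metis
qed

lemma measure_mono: "ba_measure \<mu> \<Longrightarrow> a \<le> b \<Longrightarrow> \<mu> a \<le> \<mu> b"
  using measure_diff[of \<mu> a b] by (simp add: ba_measure_def)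

lemma measure_subadditive:
  assumes "ba_measure \<mu>"
  shows "\<mu> (sup a b) \<le> \<mu> a + \<mu> b"
proof -
  have "\<mu> (sup a b) = \<mu> a + \<mu> (inf (sup a b) (- a))"
    by (rule measure_diff[OF assms]) simp
  also have "\<mu> (inf (sup a b) (- a)) \<le> \<mu> b"
    by (rule measure_mono[OF assms]) (simp add: inf_sup_distrib2)
  finally show ?thesis by simp
qed

text \<open>
  An approximation of \<open>a\<close> from above is replaced by its complement \<open>d\<close>, an approximation of \<open>- a\<close>
  from below. This makes the notion visibly symmetric under complements.
\<close>

definition squeezed :: "('a::boolean_algebra \<Rightarrow> real) \<Rightarrow> 'a set \<Rightarrow> 'a \<Rightarrow> bool" where
  "squeezed \<mu> C a \<longleftrightarrow> (\<forall>\<epsilon>>0. \<exists>c\<in>C. \<exists>d\<in>C. c \<le> a \<and> d \<le> - a \<and> \<mu> (- sup c d) < \<epsilon>)"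

lemma squeezed_uminus: "squeezed \<mu> C a \<Longrightarrow> squeezed \<mu> C (- a)"
  unfolding squeezed_def by (metis double_compl sup_commute)

lemma squeezed_member:
  assumes "ba_measure \<mu>" "subalgebra C" "a \<in> C"
  shows "squeezed \<mu> C a"
proof -
  have "- a \<in> C" "\<mu> (- sup a (- a)) = 0"
    using assms by (simp_all add: measure_bot subalgebraD)
  then show ?thesis
    using \<open>a \<in> C\<close> unfolding squeezed_def by (metis order_refl)
qed

lemma squeezed_inf:
  assumes \<mu>: "ba_measure \<mu>" and C: "subalgebra C"
    and a: "squeezed \<mu> C a" and b: "squeezed \<mu> C b"
  shows "squeezed \<mu> C (inf a b)"
  unfolding squeezed_def
proof (intro allI impI)
  fix \<epsilon> :: real
  assume "\<epsilon> > 0"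
  then have half: "\<epsilon> / 2 > 0" by simp
  obtain c d where cd: "c \<in> C" "d \<in> C" "c \<le> a" "d \<le> - a" "\<mu> (- sup c d) < \<epsilon> / 2"
    using a half unfolding squeezed_def by metis
  obtain c' d' where cd': "c' \<in> C" "d' \<in> C" "c' \<le> b" "d' \<le> - b" "\<mu> (- sup c' d') < \<epsilon> / 2"
    using b half unfolding squeezed_def by metis
  \<comment> \<open>What is decided for both \<open>a\<close> and \<open>b\<close> is decided for \<open>inf a b\<close>.\<close>
  have "inf (sup c d) (sup c' d') \<le> sup (inf c c') (sup d d')"
    by (simp add: inf_sup_distrib1 inf_sup_distrib2 le_infI1 le_infI2 le_supI1 le_supI2)
  then have "- sup (inf c c') (sup d d') \<le> sup (- sup c d) (- sup c' d')"
    by (metis compl_inf compl_mono)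
  then have "\<mu> (- sup (inf c c') (sup d d')) < \<epsilon>"
    using measure_mono[OF \<mu>] measure_subadditive[OF \<mu>, of "- sup c d" "- sup c' d'"] cd(5) cd'(5)
    by fastforce
  moreover have "inf c c' \<le> inf a b" "sup d d' \<le> - inf a b"
    using cd cd' by (auto intro: le_infI1 le_infI2 le_supI1 le_supI2)
  ultimately show "\<exists>c\<in>C. \<exists>d\<in>C. c \<le> inf a b \<and> d \<le> - inf a b \<and> \<mu> (- sup c d) < \<epsilon>"
    using cd cd' subalgebraD[OF C] by blast
qed

lemma subalgebra_squeezed:
  assumes "ba_measure \<mu>" "subalgebra C"
  shows "subalgebra {a. squeezed \<mu> C a}"
proof -
  have "squeezed \<mu> C (sup a b)" if "squeezed \<mu> C a" "squeezed \<mu> C b" for a b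
  proof -
    have "squeezed \<mu> C (- inf (- a) (- b))"
      using assms that by (intro squeezed_uminus squeezed_inf)
    then show ?thesis by simp
  qed
  then show ?thesis
    unfolding subalgebra_def
    using assms by (auto intro: squeezed_uminus squeezed_inf squeezed_member subalgebraD)
qed

lemma squeezed_imp_SUP:
  assumes \<mu>: "ba_measure \<mu>" and "subalgebra C" and a: "squeezed \<mu> C a"
  shows "\<mu> a = (SUP c\<in>{c \<in> C. c \<le> a}. \<mu> c)"
proof (rule cSup_eq_non_empty [symmetric])
  show "\<mu> ` {c \<in> C. c \<le> a} \<noteq> {}"
    using subalgebraD(1)[OF \<open>subalgebra C\<close>] by auto
  show "x \<le> \<mu> a" if "x \<in> \<mu> ` {c \<in> C. c \<le> a}" for x
    using that measure_mono[OF \<mu>] by auto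
  show "\<mu> a \<le> y" if y: "\<And>x. x \<in> \<mu> ` {c \<in> C. c \<le> a} \<Longrightarrow> x \<le> y" for y
  proof (rule field_le_epsilon)
    fix \<epsilon> :: real
    assume "\<epsilon> > 0"
    then obtain c d where c: "c \<in> C" "c \<le> a" and d: "d \<le> - a" and small: "\<mu> (- sup c d) < \<epsilon>"
      using a unfolding squeezed_def by metis
    have "a \<le> - d" using d by (metis compl_le_swap1)
    then have "inf a (- c) \<le> - sup c d" by (simp add: le_infI1)
    then have "\<mu> (inf a (- c)) \<le> \<mu> (- sup c d)" by (rule measure_mono[OF \<mu>])
    moreover have "\<mu> c \<le> y" using y c by auto
    ultimately show "\<mu> a \<le> y + \<epsilon>"
      using measure_diff[OF \<mu> \<open>c \<le> a\<close>] small by linarith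
  qed
qed

section \<open>Countable determination\<close>

text \<open>
  For \<open>F\<close> take generators whose Boolean combinations include all pieces of a fine partition. Every
  cell of \<open>F\<close> then lies inside or outside each piece, hence inside one of them or is \<open>bot\<close>.
\<close>

lemma small_cells:
  assumes \<mu>: "ba_measure \<mu>" and "nonatomic \<mu>" and G: "subalgebra hull G = UNIV" and "\<epsilon> > 0"
  shows "\<exists>F P. finite F \<and> F \<subseteq> G \<and> cells F P \<and> (\<forall>p\<in>P. \<mu> p < \<epsilon>)"
proof -
  obtain Q where Q: "finite_partition Q" "\<forall>a\<in>Q. \<mu> a < \<epsilon>"
    using \<open>nonatomic \<mu>\<close> \<open>\<epsilon> > 0\<close> unfolding nonatomic_def by blast
  have fin: "finite Q" "Q \<noteq> {}" "Sup_fin Q = top"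
    using Q(1) unfolding finite_partition_def by auto
  obtain F where F: "finite F" "F \<subseteq> G" "Q \<subseteq> subalgebra hull F"
    using finite_subset_subalgebra_hull[of Q G] fin G by auto
  obtain P where P: "cells F P" using cells_exist[OF F(1)] by blast
  have "\<mu> p < \<epsilon>" if "p \<in> P" for p
  proof (cases "\<exists>a\<in>Q. p \<le> a")
    case True
    then show ?thesis using Q(2) measure_mono[OF \<mu>] by fastforce
  next
    case False
    then have "\<forall>a\<in>Q. a \<le> - p"
      using cell_decides_generated[OF P that] F(3) compl_le_swap1 by blast
    then have "Sup_fin Q \<le> - p"
      using fin(1,2) by (simp add: Sup_fin.bounded_iff)
    then have "p = bot" using fin(3) by (metis compl_top_eq double_compl top_unique)
    then show ?thesis using measure_bot[OF \<mu>] \<open>\<epsilon> > 0\<close> by simp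
  qed
  with F P show ?thesis by blast
qed

text \<open>
  The approximations are the joins of the cells below \<open>g\<close> and of the cells below \<open>- g\<close>. What they
  leave out lies in the only cell that \<open>g\<close> may cut.
\<close>

lemma generator_squeezed:
  fixes G :: "'a::boolean_algebra set"
  assumes \<mu>: "ba_measure \<mu>"
    and G: "\<not> (\<exists>F. F \<subseteq> G \<and> card F = 2 \<and> independent_family (\<lambda>x. x) F)"
    and F: "F \<subseteq> G" "cells F P" and small: "\<forall>p\<in>P. \<mu> p < \<epsilon>" and "\<epsilon> > 0"
    and "g \<in> G" and C: "subalgebra C" "F \<subseteq> C"
  shows "\<exists>c\<in>C. \<exists>d\<in>C. c \<le> g \<and> d \<le> - g \<and> \<mu> (- sup c d) < \<epsilon>"
proof -
  have P: "finite P" "P \<subseteq> C" and cover: "\<And>y. \<forall>p\<in>P. p \<le> y \<Longrightarrow> y = top"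
    using F(2) hull_minimal[of F C subalgebra] C unfolding cells_def by auto
  obtain c where c: "c \<in> C" "\<And>y. c \<le> y \<longleftrightarrow> (\<forall>p\<in>{p \<in> P. p \<le> g}. p \<le> y)"
    using finite_join_in_subalgebra[of "{p \<in> P. p \<le> g}" C] P C(1) by auto
  obtain d where d: "d \<in> C" "\<And>y. d \<le> y \<longleftrightarrow> (\<forall>p\<in>{p \<in> P. p \<le> - g}. p \<le> y)"
    using finite_join_in_subalgebra[of "{p \<in> P. p \<le> - g}" C] P C(1) by auto
  have below: "p \<le> sup c d" if "p \<in> P" "p \<le> g \<or> p \<le> - g" for p
    using that c(2)[of c] d(2)[of d] by (auto intro: le_supI1 le_supI2)
  have "\<mu> (- sup c d) < \<epsilon>"
  proof (cases "\<exists>p\<in>P. \<not> p \<le> g \<and> \<not> p \<le> - g")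
    case True
    then obtain p where p: "p \<in> P" "\<not> p \<le> g" "\<not> p \<le> - g" by blast
    have "q \<le> sup (sup c d) p" if "q \<in> P" for q
    proof (cases "q \<le> g \<or> q \<le> - g")
      case True
      then show ?thesis by (intro le_supI1 below that)
    next
      case False
      then have "p = q"
        using splits_at_most_one_cell[OF G F \<open>g \<in> G\<close> p that] by simp
      then show ?thesis by simp
    qed
    then have "\<forall>q\<in>P. q \<le> sup (sup c d) p" by simp
    then have "sup (sup c d) p = top" by (rule cover)
    then have "- sup c d \<le> p" by (simp only: sup_shunt)
    then show ?thesis using measure_mono[OF \<mu>] small p(1) by fastforce
  next
    case False
    then have "sup c d = top" using below by (intro cover) blast
    then show ?thesis using measure_bot[OF \<mu>] \<open>\<epsilon> > 0\<close> by simp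
  qed
  moreover have "c \<le> g" "d \<le> - g" using c(2) d(2) by auto
  ultimately show ?thesis using c(1) d(1) by blast
qed

theorem proposition8p2:
  fixes \<mu> :: "'a::boolean_algebra \<Rightarrow> real"
  assumes "class_I 1 TYPE('a)"
    and "ba_measure \<mu>"
    and "nonatomic \<mu>"
  shows "strongly_countably_determined \<mu>"
proof -
  obtain G :: "'a set" where G: "subalgebra hull G = UNIV"
    and no_pair: "\<not> (\<exists>F. F \<subseteq> G \<and> card F = 2 \<and> independent_family (\<lambda>x. x) F)"
    using assms(1) unfolding class_I_def by auto
  obtain F P where FP: "\<And>n::nat. finite (F n) \<and> F n \<subseteq> G \<and> cells (F n) (P n) \<and>
      (\<forall>p\<in>P n. \<mu> p < 1 / real (Suc n))"
    using small_cells[OF assms(2,3) G, of "1 / real (Suc n)" for n] by (simp, metis)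
  define C where "C = subalgebra hull (\<Union>n. F n)"
  have C: "subalgebra C" "F n \<subseteq> C" for n
    unfolding C_def using subalgebra_hull hull_subset[of "\<Union>n. F n" subalgebra] by auto
  have "squeezed \<mu> C g" if "g \<in> G" for g
    unfolding squeezed_def
  proof (intro allI impI)
    fix \<epsilon> :: real
    assume "\<epsilon> > 0"
    then obtain n where "1 / real (Suc n) < \<epsilon>" by (rule nat_approx_posE)
    moreover have "\<exists>c\<in>C. \<exists>d\<in>C. c \<le> g \<and> d \<le> - g \<and> \<mu> (- sup c d) < 1 / real (Suc n)"
      using generator_squeezed[OF assms(2) no_pair, of "F n" "P n"] FP[of n] that C by simp
    ultimately show "\<exists>c\<in>C. \<exists>d\<in>C. c \<le> g \<and> d \<le> - g \<and> \<mu> (- sup c d) < \<epsilon>"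
      by (meson less_trans)
  qed
  then have "subalgebra hull G \<subseteq> {a. squeezed \<mu> C a}"
    using subalgebra_squeezed[OF assms(2) C(1)] by (intro hull_minimal) auto
  then have "squeezed \<mu> C a" for a using G by auto
  then have "\<forall>a. \<mu> a = (SUP c\<in>{c \<in> C. c \<le> a}. \<mu> c)"
    by (intro allI squeezed_imp_SUP[OF assms(2) C(1)])
  moreover have "countable C"
    unfolding C_def by (intro countable_subalgebra_hull) (simp add: FP countable_finite)
  ultimately show ?thesis
    unfolding strongly_countably_determined_def by (intro exI[of _ C] conjI C(1))
qed

end
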